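(* Work over the semifield $\mathbb{R}_{\max,+}$ and let $n\geq1$. Let $\mathbf{C}\in\mathbb{R}_{\max,+}^{n\times n}$ be a column-regular matrix, $\mathbf{g}\in\mathbb{R}_{\max,+}^{n}$ a vector, and $\mathbf{f}\in\mathbb{R}_{\max,+}^{n}$ a regular vector such that $\mathbf{f}^{-}\mathbf{C}\mathbf{g}\leq\mathbb{1}$. Consider the problem of minimizing $\mathbf{1}^{T}\mathbf{C}\mathbf{x}\mathbf{x}^{-}\mathbf{1}$ over all regular vectors $\mathbf{x}$ (i.e. $\mathbf{x}\in\mathbb{R}^{n}$) subject to $\mathbf{C}\mathbf{x}\leq\mathbf{f}$ and $\mathbf{g}\leq\mathbf{x}$. Then the minimum value in this problem is equal to $$\theta=\mathbf{1}^{T}\mathbf{C}(\mathbf{I}\oplus\mathbf{g}\mathbf{f}^{-}\mathbf{C})\mathbf{1}=\|\mathbf{C}\|\oplus\|\mathbf{C}\mathbf{g}\|\,\|\mathbf{f}^{-}\mathbf{C}\|,$$ and all regular solutions of the problem are given by $$\mathbf{x}=(\mathbf{I}\oplus\theta^{-1}\mathbf{1}\mathbf{1}^{T}\mathbf{C})\mathbf{u},\qquad \mathbf{g}\leq\mathbf{u}\leq(\mathbf{f}^{-}\mathbf{C}(\mathbf{I}\oplus\theta^{-1}\mathbf{1}\mathbf{1}^{T}\mathbf{C}))^{-};$$ that is, a regular vector $\mathbf{x}$ is a solution of the problem if and only if it has this form for some $\mathbf{u}\in\mathbb{R}_{\max,+}^{n}$ satisfying the stated double inequality.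
   Context: $\mathbb{R}_{\max,+}=(\mathbb{R}\cup\{-\infty\},\max,+,-\infty,0)$ is the max-plus semifield: $\oplus=\max$, $\otimes=+$ (multiplication sign omitted), zero $\mathbb{0}=-\infty$, one $\mathbb{1}=0$, and $x^{-1}=-x$ for $x\in\mathbb{R}$; the order is the usual one. All matrix/vector operations follow the usual rules with these $\oplus,\otimes$; inequalities are componentwise. $\mathbf{1}=(0,\ldots,0)^{T}$ is the column vector of $n$ zeros; $\mathbf{I}$ is the identity matrix ($0$ on the diagonal, $-\infty$ elsewhere). A vector is regular if none of its entries is $-\infty$; a matrix is column-regular if it has no column consisting entirely of $-\infty$. For a nonzero vector (not all entries $-\infty$), the conjugate transpose $\mathbf{x}^{-}$ of a column (row) vector $\mathbf{x}$ is the row (column) vector with entries $-x_{i}$ if $x_{i}\neq-\infty$ and $-\infty$ otherwise. $\|\mathbf{A}\|=\bigoplus_{i,j}a_{ij}$ is the maximum entry of a matrix or vector $\mathbf{A}$. In ordinary notation, the objective is $\max_{i,j}(c_{ij}+x_{j})+\max_{k}(-x_{k})$. *)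

theory Defs
  imports "HOL-Analysis.Analysis"
begin

text \<open>
  The max-plus semifield: \<open>+\<close> is the maximum, \<open>*\<close> is the addition of reals extended to
  \<open>NegInf\<close> (minus infinity), so that \<open>0 = NegInf\<close> and \<open>1 = Fin 0\<close>. As it is a commutative
  semiring, the library's matrix operations \<open>**\<close>, \<open>*v\<close>, \<open>v*\<close>, \<open>mat 1\<close>, \<open>+\<close> and the
  componentwise order on vectors are the max-plus ones.
\<close>

datatype maxplus = NegInf | Fin real

instantiation maxplus :: linorder
begin

fun less_eq_maxplus :: "maxplus \<Rightarrow> maxplus \<Rightarrow> bool" where
  "NegInf \<le> y \<longleftrightarrow> True"
| "Fin a \<le> NegInf \<longleftrightarrow> False"
| "Fin a \<le> Fin b \<longleftrightarrow> a \<le> b"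

definition less_maxplus :: "maxplus \<Rightarrow> maxplus \<Rightarrow> bool" where
  "x < y \<longleftrightarrow> x \<le> y \<and> \<not> y \<le> (x :: maxplus)"

instance
proof
  fix x y z :: maxplus
  show "x < y \<longleftrightarrow> x \<le> y \<and> \<not> y \<le> x" by (rule less_maxplus_def)
  show "x \<le> x" by (cases x) auto
  show "x \<le> y \<Longrightarrow> y \<le> z \<Longrightarrow> x \<le> z" by (cases x; cases y; cases z) auto
  show "x \<le> y \<Longrightarrow> y \<le> x \<Longrightarrow> x = y" by (cases x; cases y) auto
  show "x \<le> y \<or> y \<le> x" by (cases x; cases y) auto
qed

end

instantiation maxplus :: comm_semiring_1
begin

definition zero_maxplus :: maxplus where "0 = NegInf"

definition one_maxplus :: maxplus where "1 = Fin 0"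

definition plus_maxplus :: "maxplus \<Rightarrow> maxplus \<Rightarrow> maxplus" where "x + y = max x (y :: maxplus)"

fun times_maxplus :: "maxplus \<Rightarrow> maxplus \<Rightarrow> maxplus" where
  "NegInf * y = NegInf"
| "Fin a * NegInf = NegInf"
| "Fin a * Fin b = Fin (a + b)"

instance
proof
  fix x y z :: maxplus
  show "x + y + z = x + (y + z)" by (simp add: plus_maxplus_def max.assoc)
  show "x + y = y + x" by (simp add: plus_maxplus_def max.commute)
  show "0 + x = x" by (cases x) (auto simp: plus_maxplus_def zero_maxplus_def max_def)
  show "x * y * z = x * (y * z)" by (cases x; cases y; cases z) auto
  show "x * y = y * x" by (cases x; cases y) auto
  show "1 * x = x" by (cases x) (auto simp: one_maxplus_def)
  show "(x + y) * z = x * z + y * z"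
    by (cases x; cases y; cases z) (auto simp: plus_maxplus_def max_def)
  show "0 * x = 0" by (simp add: zero_maxplus_def)
  show "x * 0 = 0" by (cases x) (auto simp: zero_maxplus_def)
  show "(0::maxplus) \<noteq> 1" by (simp add: zero_maxplus_def one_maxplus_def)
qed

end

text \<open>The clause for \<open>NegInf\<close> is the convention used entrywise in the conjugate transpose.\<close>

fun mp_inv :: "maxplus \<Rightarrow> maxplus" where
  "mp_inv NegInf = NegInf"
| "mp_inv (Fin a) = Fin (- a)"

definition regular :: "maxplus ^ 'n \<Rightarrow> bool" where
  "regular x \<longleftrightarrow> (\<forall>i. x $ i \<noteq> 0)"

definition column_regular :: "maxplus ^ 'n ^ 'm \<Rightarrow> bool" where
  "column_regular A \<longleftrightarrow> (\<forall>j. \<exists>i. A $ i $ j \<noteq> 0)"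

text \<open>
  Rows and columns share the type \<^typ>\<open>maxplus ^ 'n\<close>, so transposing a vector is silent:
  \<open>dot r c\<close> is the scalar product of a row and a column, \<open>outer c r\<close> the matrix product of
  a column and a row.
\<close>

definition conj_transpose :: "maxplus ^ 'n \<Rightarrow> maxplus ^ 'n"  (\<open>(_\<^sup>-)\<close> [1000] 999) where
  "x\<^sup>- = (\<chi> i. mp_inv (x $ i))"

definition dot :: "maxplus ^ 'n \<Rightarrow> maxplus ^ 'n \<Rightarrow> maxplus" where
  "dot r c = (\<Sum>i\<in>UNIV. r $ i * c $ i)"

definition outer :: "maxplus ^ 'm \<Rightarrow> maxplus ^ 'n \<Rightarrow> maxplus ^ 'n ^ 'm" where
  "outer c r = (\<chi> i j. c $ i * r $ j)"

definition scale_mat :: "maxplus \<Rightarrow> maxplus ^ 'n ^ 'm \<Rightarrow> maxplus ^ 'n ^ 'm" where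
  "scale_mat k A = (\<chi> i j. k * A $ i $ j)"

text \<open>These sums are maxima.\<close>

definition vec_norm :: "maxplus ^ 'n \<Rightarrow> maxplus" where
  "vec_norm x = (\<Sum>i\<in>UNIV. x $ i)"

definition mat_norm :: "maxplus ^ 'n ^ 'm \<Rightarrow> maxplus" where
  "mat_norm A = (\<Sum>i\<in>UNIV. \<Sum>j\<in>UNIV. A $ i $ j)"

definition feasible :: "maxplus ^ 'n ^ 'n \<Rightarrow> maxplus ^ 'n \<Rightarrow> maxplus ^ 'n \<Rightarrow> maxplus ^ 'n \<Rightarrow> bool" where
  "feasible C f g x \<longleftrightarrow> regular x \<and> C *v x \<le> f \<and> g \<le> x"

text \<open>\<open>1\<close> as a vector is the all-ones vector, whose entries are the real number zero.\<close>

definition objective :: "maxplus ^ 'n ^ 'n \<Rightarrow> maxplus ^ 'n \<Rightarrow> maxplus" where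
  "objective C x = dot (1 v* (C ** outer x (x\<^sup>-))) 1"

end

theory Submission
  imports Defs
begin

text \<open>
  Two rows carry the whole problem: \<open>s = 1 v* C\<close>, the column maxima of \<open>C\<close>, and
  \<open>h = f\<^sup>- v* C\<close>. Both are regular because \<open>C\<close> is column-regular
  and \<open>f\<close> is regular. The constraint
  \<open>C *v x \<le> f\<close> is the single inequality \<open>dot h x \<le> 1\<close>, that is \<open>x \<le> h\<^sup>-\<close>, and the objective is the
  product \<open>dot s x * vec_norm (x\<^sup>-)\<close>.

  Lower bound. On the diagonal the objective contains \<open>s $ j * x $ j * mp_inv (x $ j) = s $ j\<close>, so it is at
  least \<open>vec_norm s\<close>. For \<open>g \<le> x \<le> h\<^sup>-\<close> its two factors are at least \<open>dot s g\<close> and \<open>vec_norm h\<close>. The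
  maximum of these two bounds is \<open>\<theta>\<close>.

  Solutions. Solving \<open>dot s x * vec_norm (x\<^sup>-) \<le> \<theta>\<close> for \<open>x\<close> gives the linear inequality
  \<open>\<theta>\<^sup>-\<^sup>1 1 s x \<le> x\<close> (lemma \<open>mult_vec_norm_conj_transpose_le_iff\<close>), which says that \<open>x\<close> is a fixed
  point of \<open>B = I + \<theta>\<^sup>-\<^sup>1 1 s\<close>. Since \<open>\<theta> \<ge> vec_norm s\<close>, the matrix \<open>B\<close> is idempotent
  (lemma \<open>closure_is_fixed\<close>), so its fixed points are exactly the vectors \<open>B *v u\<close>. In terms of \<open>u\<close>, the
  upper constraint reads \<open>dot (h v* B) u \<le> 1\<close>, or \<open>u \<le> (h v* B)\<^sup>-\<close>. As \<open>u \<le> B *v u\<close>, the bound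
  \<open>g \<le> u\<close> implies the lower constraint, and a solution \<open>x\<close> has itself as parameter.

  Attainment. The interval for \<open>u\<close> is nonempty exactly when \<open>dot (h v* B) g \<le> 1\<close>, which unfolds to
  \<open>dot h g \<le> 1\<close> (the hypothesis) and \<open>dot s g * vec_norm h \<le> \<theta>\<close> (the second part of \<open>\<theta>\<close>).
\<close>

section \<open>The ordered semifield\<close>

instance maxplus :: ordered_comm_semiring
proof
  fix a b c :: maxplus
  show "a \<le> b \<Longrightarrow> c + a \<le> c + b"
    by (auto simp: plus_maxplus_def max.coboundedI2)
  show "a \<le> b \<Longrightarrow> 0 \<le> c \<Longrightarrow> c * a \<le> c * b"
    by (cases a; cases b; cases c) auto
qed

lemma maxplus_zero_le [simp]: "0 \<le> (x :: maxplus)"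
  by (simp add: zero_maxplus_def)

lemma maxplus_le_zero_iff [simp]: "x \<le> 0 \<longleftrightarrow> x = (0 :: maxplus)"
  by (auto intro: antisym)

lemma maxplus_add_le_iff [simp]: "x + y \<le> z \<longleftrightarrow> x \<le> z \<and> y \<le> (z :: maxplus)"
  by (simp add: plus_maxplus_def)

lemma maxplus_add_absorb: "x \<le> y \<Longrightarrow> y + x = (y :: maxplus)"
  by (simp add: plus_maxplus_def max_absorb1)

lemma maxplus_le_add [simp]: "x \<le> x + (y :: maxplus)" "y \<le> x + (y :: maxplus)"
  by (simp_all add: plus_maxplus_def)

lemma maxplus_sum_le_iff:
  fixes F :: "'a \<Rightarrow> maxplus"
  assumes "finite A"
  shows "sum F A \<le> z \<longleftrightarrow> (\<forall>i\<in>A. F i \<le> z)"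
  using assms by (induction A rule: finite_induct) auto

lemma maxplus_mult_mono: "a \<le> b \<Longrightarrow> c \<le> d \<Longrightarrow> a * c \<le> b * (d :: maxplus)"
  by (rule mult_mono) auto

lemma mp_inv_eq_zero_iff [simp]: "mp_inv a = 0 \<longleftrightarrow> a = 0"
  by (cases a) (auto simp: zero_maxplus_def)

lemma mp_inv_mp_inv [simp]: "mp_inv (mp_inv a) = a"
  by (cases a) auto

lemma mp_inv_mult: "a \<noteq> 0 \<Longrightarrow> mp_inv a * a = 1"
  by (cases a) (auto simp: zero_maxplus_def one_maxplus_def)

text \<open>Multiplication by a nonzero element has its inverse as residual, because the
  nonzero elements form an ordered group. The constraint and the bound on the objective are both
  solved for \<open>x\<close> by this equivalence.\<close>

lemma maxplus_mult_le_iff: "a \<noteq> 0 \<Longrightarrow> a * x \<le> y \<longleftrightarrow> x \<le> mp_inv a * y"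
  by (cases a; cases x; cases y) (auto simp: zero_maxplus_def)

section \<open>Scalar products and residuation of vectors\<close>

lemma dot_le_iff: "dot r x \<le> z \<longleftrightarrow> (\<forall>i. r $ i * x $ i \<le> z)"
  by (simp add: dot_def maxplus_sum_le_iff)

lemma dot_mono: "x \<le> y \<Longrightarrow> dot r x \<le> dot r y"
  unfolding dot_def by (intro sum_mono maxplus_mult_mono) (auto simp: less_eq_vec_def)

lemma dot_one_right: "dot r 1 = vec_norm r"
  by (simp add: dot_def vec_norm_def)

lemma dot_one_left: "dot 1 x = vec_norm x"
  by (simp add: dot_def vec_norm_def)

lemma dot_axis: "dot r (axis j 1) = r $ j"
  by (simp add: dot_def axis_def if_distrib cong: if_cong)

lemma dot_add_right: "dot r (x + y) = dot r x + dot r y"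
  by (simp add: dot_def algebra_simps sum.distrib)

lemma dot_scale_right: "dot r (k *s x) = k * dot r x"
  by (simp add: dot_def sum_distrib_left mult_ac)

lemma dot_vector_matrix: "dot (r v* A) x = dot r (A *v x)"
proof -
  have "dot (r v* A) x = (\<Sum>j\<in>UNIV. \<Sum>i\<in>UNIV. r $ i * (A $ i $ j * x $ j))"
    by (simp add: dot_def vector_matrix_mult_def sum_distrib_left mult_ac)
  also have "\<dots> = dot r (A *v x)"
    by (subst sum.swap) (simp add: dot_def matrix_vector_mult_def sum_distrib_left)
  finally show ?thesis .
qed

lemma outer_matrix_vector: "outer c r *v x = dot r x *s c"
  by (simp add: vec_eq_iff outer_def matrix_vector_mult_def dot_def sum_distrib_left
      sum_distrib_right mult_ac)

lemma scale_mat_matrix_vector: "scale_mat k A *v x = k *s (A *v x)"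
  by (simp add: vec_eq_iff scale_mat_def matrix_vector_mult_def sum_distrib_left mult_ac)

lemma mat_norm_eq: "mat_norm A = vec_norm (A *v 1)"
  by (simp add: mat_norm_def vec_norm_def matrix_vector_mult_def)

lemma conj_transpose_nth [simp]: "x\<^sup>- $ i = mp_inv (x $ i)"
  by (simp add: conj_transpose_def)

lemma conj_transpose_conj_transpose [simp]: "(x\<^sup>-)\<^sup>- = x"
  by (simp add: vec_eq_iff)

lemma regular_conj_transpose [simp]: "regular (x\<^sup>-) \<longleftrightarrow> regular x"
  by (simp add: regular_def)

lemma regular_mono: "regular x \<Longrightarrow> x \<le> y \<Longrightarrow> regular y"
  unfolding regular_def less_eq_vec_def by (metis maxplus_le_zero_iff)

text \<open>The conjugate transpose of a regular row is the greatest solution of \<open>dot r x \<le> 1\<close>. For a row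
  with a zero entry this would fail: that entry leaves \<open>x\<close> unbounded, but its conjugate is again
  zero.\<close>

lemma dot_le_one_iff: "regular r \<Longrightarrow> dot r x \<le> 1 \<longleftrightarrow> x \<le> r\<^sup>-"
  by (simp add: dot_le_iff less_eq_vec_def maxplus_mult_le_iff regular_def)

text \<open>Inversion reverses the order of nonzero elements but keeps zero as the least one; regularity
  of the smaller vector excludes the zeros.\<close>

lemma vec_norm_conj_transpose_antimono:
  assumes "regular x" "x \<le> y"
  shows "vec_norm (y\<^sup>-) \<le> vec_norm (x\<^sup>-)"
proof -
  have "mp_inv b \<le> mp_inv a" if "a \<noteq> 0" "a \<le> b" for a b
    using that by (cases a; cases b) (auto simp: zero_maxplus_def)
  with assms show ?thesis
    unfolding vec_norm_def
    by (intro sum_mono) (auto simp: regular_def less_eq_vec_def)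
qed

lemma regular_vector_matrix:
  assumes "regular r" "column_regular A"
  shows "regular (r v* A)"
  unfolding regular_def
proof
  fix j
  obtain i where i: "A $ i $ j \<noteq> 0"
    using assms(2) by (auto simp: column_regular_def)
  have "r $ i * A $ i $ j \<noteq> 0"
    using assms(1) i
    by (cases "r $ i"; cases "A $ i $ j") (auto simp: regular_def zero_maxplus_def)
  moreover have "r $ i * A $ i $ j \<le> (r v* A) $ j"
    using maxplus_sum_le_iff[of UNIV "\<lambda>i. r $ i * A $ i $ j" "(r v* A) $ j"]
    by (simp add: vector_matrix_mult_def mult.commute)
  ultimately show "(r v* A) $ j \<noteq> 0"
    by (metis maxplus_le_zero_iff)
qed

section \<open>The constraint and the objective\<close>

lemma matrix_vector_le_iff:
  assumes "regular f"
  shows "C *v x \<le> f \<longleftrightarrow> dot (f\<^sup>- v* C) x \<le> 1"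
  using dot_le_one_iff[of "f\<^sup>-" "C *v x"] assms by (simp add: dot_vector_matrix)

text \<open>The matrix in the objective has the rank-one factor \<open>outer x (x\<^sup>-)\<close>, so the value splits into a
  part increasing and a part decreasing in \<open>x\<close>.\<close>

lemma objective_eq: "objective C x = dot (1 v* C) x * vec_norm (x\<^sup>-)"
proof -
  have "objective C x = dot (1 v* C) (outer x (x\<^sup>-) *v 1)"
    by (simp only: objective_def dot_vector_matrix matrix_vector_mul_assoc)
  also have "\<dots> = dot (1 v* C) x * vec_norm (x\<^sup>-)"
    by (simp only: outer_matrix_vector dot_scale_right dot_one_right mult.commute)
  finally show ?thesis .
qed

text \<open>The maximum over \<open>k\<close> of \<open>a * mp_inv (x $ k)\<close> is at most \<open>t\<close> iff every term is, and each
  term is solved for \<open>x $ k\<close> by residuation. With \<open>a = dot s x\<close> this turns a bound on the objective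
  into an inequality linear in \<open>x\<close>.\<close>

lemma mult_vec_norm_conj_transpose_le_iff:
  assumes "regular x" "t \<noteq> 0"
  shows "a * vec_norm (x\<^sup>-) \<le> t \<longleftrightarrow> mp_inv t * a *s 1 \<le> x"
proof -
  have "a * mp_inv (x $ k) \<le> t \<longleftrightarrow> mp_inv t * a \<le> x $ k" for k
    using assms maxplus_mult_le_iff[of "mp_inv (x $ k)" a t]
      maxplus_mult_le_iff[of "mp_inv t" a "x $ k"]
    by (simp add: regular_def mult.commute)
  then show ?thesis
    by (simp add: vec_norm_def sum_distrib_left maxplus_sum_le_iff less_eq_vec_def)
qed

text \<open>In the product of the two maxima, the diagonal terms
  \<open>s $ j * x $ j * mp_inv (x $ j)\<close> cancel to \<open>s $ j\<close>.\<close>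

lemma vec_norm_le_dot_mult_vec_norm_conj_transpose:
  assumes "regular x"
  shows "vec_norm s \<le> dot s x * vec_norm (x\<^sup>-)"
proof -
  have "s $ j \<le> dot s x * vec_norm (x\<^sup>-)" for j
  proof -
    have "s $ j = s $ j * x $ j * mp_inv (x $ j)"
      using assms mp_inv_mult[of "x $ j"] by (simp add: regular_def mult_ac)
    also have "\<dots> \<le> dot s x * vec_norm (x\<^sup>-)"
      using dot_le_iff[of s x "dot s x"]
        maxplus_sum_le_iff[of UNIV "\<lambda>i. mp_inv (x $ i)" "vec_norm (x\<^sup>-)"]
      by (intro maxplus_mult_mono) (auto simp: vec_norm_def)
    finally show ?thesis .
  qed
  then show ?thesis
    by (simp add: vec_norm_def maxplus_sum_le_iff)
qed

section \<open>The generating matrix\<close>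

lemma generator_matrix_vector:
  "(mat 1 + scale_mat k (outer 1 1 ** C)) *v u = u + k * dot (1 v* C) u *s 1"
  by (simp add: matrix_vector_mult_add_rdistrib scale_mat_matrix_vector outer_matrix_vector
      dot_vector_matrix flip: matrix_vector_mul_assoc)

text \<open>A vector of the form \<open>u + k 1 s u\<close> satisfies the linear inequality \<open>k 1 s x \<le> x\<close>: adding the
  constant vector \<open>k * dot s u\<close> raises \<open>dot s u\<close> only to its maximum with \<open>(k * vec_norm s) * dot s u\<close>,
  which is no larger when \<open>k * vec_norm s \<le> 1\<close>. Hence \<open>I + k 1 s\<close> is idempotent.\<close>

lemma closure_is_fixed:
  assumes "k * vec_norm s \<le> 1"
  shows "k * dot s (u + k * dot s u *s 1) *s 1 \<le> u + k * dot s u *s 1"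
proof -
  have "dot s (u + k * dot s u *s 1) = dot s u + (k * vec_norm s) * dot s u"
    by (simp add: dot_add_right dot_scale_right dot_one_right mult_ac)
  also have "\<dots> = dot s u"
    using maxplus_mult_mono[OF assms order_refl, of "dot s u"]
    by (simp add: maxplus_add_absorb)
  finally show ?thesis
    by (simp add: less_eq_vec_def)
qed

theorem theorem11:
  fixes C :: "maxplus ^ 'n ^ 'n" and f g :: "maxplus ^ 'n" and \<theta> :: maxplus
  assumes "column_regular C"
    and "regular f"
    and "dot (f\<^sup>- v* C) g \<le> 1"
    and \<theta>: "\<theta> = dot (1 v* (C ** (mat 1 + outer g (f\<^sup>- v* C)))) 1"
  shows "\<theta> = mat_norm C + vec_norm (C *v g) * vec_norm (f\<^sup>- v* C)
    \<and> (\<exists>x. feasible C f g x \<and> objective C x = \<theta>)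
    \<and> (\<forall>x. feasible C f g x \<longrightarrow> \<theta> \<le> objective C x)
    \<and> (\<forall>x. regular x \<longrightarrow>
        (is_arg_min (objective C) (feasible C f g) x \<longleftrightarrow>
         (\<exists>u. x = (mat 1 + scale_mat (mp_inv \<theta>) (outer 1 1 ** C)) *v u
            \<and> g \<le> u
            \<and> u \<le> (f\<^sup>- v* (C ** (mat 1 + scale_mat (mp_inv \<theta>) (outer 1 1 ** C))))\<^sup>-)))"
proof -
  define s where "s = 1 v* C"
  define h where "h = f\<^sup>- v* C"
  define B where "B = mat 1 + scale_mat (mp_inv \<theta>) (outer 1 1 ** C)"
  define q where "q = f\<^sup>- v* (C ** B)"
  have B: "B *v u = u + mp_inv \<theta> * dot s u *s 1" for u
    by (simp add: B_def s_def generator_matrix_vector)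
  have q: "dot q u = dot h (B *v u)" for u
    by (simp add: q_def h_def dot_vector_matrix flip: matrix_vector_mul_assoc)

  have \<theta>_eq: "\<theta> = vec_norm s + dot s g * vec_norm h"
  proof -
    have "\<theta> = dot s ((mat 1 + outer g h) *v 1)"
      by (simp only: \<theta> s_def h_def dot_vector_matrix matrix_vector_mul_assoc)
    then show ?thesis
      by (simp add: matrix_vector_mult_add_rdistrib outer_matrix_vector dot_add_right
          dot_scale_right dot_one_right mult.commute)
  qed
  have norms: "mat_norm C = vec_norm s" "vec_norm (C *v g) = dot s g"
    using dot_vector_matrix[of 1 C 1] dot_vector_matrix[of 1 C g]
    by (simp_all add: mat_norm_eq s_def dot_one_left dot_one_right)

  have s: "regular s" and h: "regular h"
    using assms(1,2) by (auto simp: s_def h_def intro!: regular_vector_matrix)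
      (simp add: regular_def)
  have \<theta>_nz: "\<theta> \<noteq> 0"
  proof
    assume "\<theta> = 0"
    then have "vec_norm s \<le> 0"
      by (metis \<theta>_eq maxplus_le_add(1))
    then show False
      using s by (auto simp: vec_norm_def maxplus_sum_le_iff regular_def simp del: maxplus_le_zero_iff) auto
  qed
  have inv_s: "mp_inv \<theta> * vec_norm s \<le> 1"
    using \<theta>_nz \<theta>_eq maxplus_mult_le_iff[of "mp_inv \<theta>" "vec_norm s" 1] by simp

  have u_le: "u \<le> B *v u" for u
    by (simp add: B less_eq_vec_def)
  have q_reg: "regular q"
  proof -
    have "dot h u \<le> dot q u" for u
      using q dot_mono[OF u_le] by simp
    \<comment> \<open>Unit vectors read off the entries of a row.\<close>
    from this[of "axis _ 1"] have "h \<le> q"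
      by (simp add: dot_axis less_eq_vec_def)
    then show ?thesis
      using h regular_mono by blast
  qed

  have feasible: "feasible C f g x \<longleftrightarrow> regular x \<and> dot h x \<le> 1 \<and> g \<le> x" for x
    using assms(2) by (simp add: feasible_def h_def matrix_vector_le_iff)
  have obj_le: "objective C x \<le> \<theta> \<longleftrightarrow> mp_inv \<theta> * dot s x *s 1 \<le> x" if "regular x" for x
    using that \<theta>_nz by (simp add: objective_eq s_def mult_vec_norm_conj_transpose_le_iff)

  have lower: "\<theta> \<le> objective C x" if "feasible C f g x" for x
  proof -
    have x: "regular x" "x \<le> h\<^sup>-" "g \<le> x"
      using that h by (auto simp: feasible dot_le_one_iff)
    then have "vec_norm h \<le> vec_norm (x\<^sup>-)"
      using vec_norm_conj_transpose_antimono[of x "h\<^sup>-"] by simp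
    then have "dot s g * vec_norm h \<le> objective C x"
      using dot_mono[OF x(3)] by (simp add: objective_eq s_def maxplus_mult_mono)
    moreover have "vec_norm s \<le> objective C x"
      using vec_norm_le_dot_mult_vec_norm_conj_transpose[OF x(1)]
      by (simp add: objective_eq s_def)
    ultimately show ?thesis
      by (simp add: \<theta>_eq)
  qed

  have generated: "feasible C f g (B *v u) \<and> objective C (B *v u) = \<theta>"
    if "regular (B *v u)" "g \<le> u" "u \<le> q\<^sup>-" for u
  proof -
    have "dot h (B *v u) \<le> 1"
      using that(3) q_reg by (simp add: dot_le_one_iff flip: q)
    then have feas: "feasible C f g (B *v u)"
      using that(1,2) u_le[of u] by (auto simp: feasible)
    moreover have "objective C (B *v u) \<le> \<theta>"
      using that(1) closure_is_fixed[OF inv_s] by (simp add: obj_le B)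
    ultimately show ?thesis
      using lower by (simp add: order.antisym)
  qed

  have "dot q g \<le> 1"
  proof -
    have "dot q g = dot h g + mp_inv \<theta> * (dot s g * vec_norm h)"
      by (simp add: q B dot_add_right dot_scale_right dot_one_right mult_ac)
    moreover have "mp_inv \<theta> * (dot s g * vec_norm h) \<le> 1"
      using \<theta>_nz \<theta>_eq maxplus_mult_le_iff[of "mp_inv \<theta>" "dot s g * vec_norm h" 1] by simp
    ultimately show ?thesis
      using assms(3) by (simp add: h_def)
  qed
  then have g_le: "g \<le> q\<^sup>-"
    using q_reg by (simp add: dot_le_one_iff)
  \<comment> \<open>The greatest admissible parameter \<open>q\<^sup>-\<close> is regular, hence so is the solution that it generates;
    \<open>g\<close> itself may have zero entries.\<close>
  have attained: "\<exists>x. feasible C f g x \<and> objective C x = \<theta>"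
    using generated[OF _ g_le order_refl] u_le q_reg regular_mono regular_conj_transpose by blast

  have "is_arg_min (objective C) (feasible C f g) x \<longleftrightarrow> (\<exists>u. x = B *v u \<and> g \<le> u \<and> u \<le> q\<^sup>-)"
    if "regular x" for x
  proof
    assume "is_arg_min (objective C) (feasible C f g) x"
    then have feas: "feasible C f g x" and "objective C x \<le> \<theta>"
      using attained by (auto simp: is_arg_min_def not_less)
    then have "B *v x = x"
      using that by (simp add: obj_le B vec_eq_iff less_eq_vec_def maxplus_add_absorb)
    moreover from this have "x \<le> q\<^sup>-"
      using feas q_reg by (simp add: feasible q flip: dot_le_one_iff)
    ultimately show "\<exists>u. x = B *v u \<and> g \<le> u \<and> u \<le> q\<^sup>-"
      using feas feasible by metis
  next
    assume "\<exists>u. x = B *v u \<and> g \<le> u \<and> u \<le> q\<^sup>-"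
    then show "is_arg_min (objective C) (feasible C f g) x"
      using generated that lower by (auto simp: is_arg_min_def not_less)
  qed
  then show ?thesis
    using \<theta>_eq norms attained lower by (simp add: B_def q_def h_def)
qed

end
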